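(* Let $A\in\mathbb{C}^{n\times n}$ have index $k\ge 1$, with $\operatorname{rank}(A^{\sim}AA^{\sim})=\operatorname{rank}(A)>0$ and $A^{k}\neq 0$. Let $$A=B_1C_1,\quad C_1B_1=B_2C_2,\quad C_2B_2=B_3C_3,\ \dots,\ C_{k-1}B_{k-1}=B_kC_k$$ be such that $B_1C_1$ is a full-rank factorization of $A$ and $B_{i+1}C_{i+1}$ is a full-rank factorization of $C_iB_i$ for $i=1,2,\dots,k-1$. Then $$A^{D,\mathfrak{m}}=\int_{0}^{\infty}M\exp(-B_1^{\sim}B_1t)B_1^{\sim}\,dt,$$ where $M=B_1\cdots B_k(C_kB_k)^{-k}C_k\cdots C_2$.
   Context: A full-rank factorization of a matrix $M$ of rank $s>0$ is $M=BC$ with $B$ having $s$ columns and full column rank and $C$ having $s$ rows and full row rank. For $k=1$ the product $C_k\cdots C_2$ is empty (the identity). The index of $A\in\mathbb{C}^{n\times n}$ is the smallest nonnegative integer $k$ with $\operatorname{rank}(A^{k+1})=\operatorname{rank}(A^{k})$. The Minkowski metric matrix of order $p$ is $\operatorname{diag}(1,-I_{p-1})$. For $M\in\mathbb{C}^{m\times p}$, the Minkowski adjoint is $M^{\sim}=GM^{*}F$, where $M^*$ is the conjugate transpose and $G$ and $F$ are the Minkowski metric matrices of orders $p$ and $m$, respectively. The Drazin inverse $A^{D}$ of $A$ (of index $k$) is the unique $X$ with $XAX=X$, $AX=XA$, $A^{k+1}X=A^{k}$. The Minkowski inverse $A^{\mathfrak{m}}$ is the unique matrix $X$ (if it exists)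 with $AXA=A$, $XAX=X$, $(AX)^{\sim}=AX$, $(XA)^{\sim}=XA$; it exists if and only if $\operatorname{rank}(A^{\sim}AA^{\sim})=\operatorname{rank}(A)$. When it exists, the $\mathfrak{m}$-DMP inverse of $A$ is $A^{D,\mathfrak{m}}=A^{D}AA^{\mathfrak{m}}$.
   Formalization: The formal statement also assumes that the integral on the right converges; without this the claim fails, e.g. for A = diag(0,1), B_1 = (0,1)^T, C_1 = (0,1), where B_1^~B_1 = -1 and the integrand diag(0,-e^t) diverges. *)

theory Defs
  imports
    "HOL-Analysis.Henstock_Kurzweil_Integration"
    "Jordan_Normal_Form.DL_Rank"
    "Jordan_Normal_Form.Schur_Decomposition"
    "Jordan_Normal_Form.Gauss_Jordan_Elimination"
begin

definition mat_rank :: "complex mat \<Rightarrow> nat" where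
  "mat_rank A = vec_space.rank (dim_row A) A"

definition full_rank_factorization ::
    "complex mat \<Rightarrow> complex mat \<Rightarrow> complex mat \<Rightarrow> bool" where
  "full_rank_factorization M B C \<longleftrightarrow>
     (let s = mat_rank M in
        s > 0 \<and>
        B \<in> carrier_mat (dim_row M) s \<and> mat_rank B = s \<and>
        C \<in> carrier_mat s (dim_col M) \<and> mat_rank C = s \<and>
        M = B * C)"

definition mat_index :: "complex mat \<Rightarrow> nat" where
  "mat_index A = (LEAST k. mat_rank (A ^\<^sub>m (k + 1)) = mat_rank (A ^\<^sub>m k))"

definition minkowski_metric :: "nat \<Rightarrow> complex mat" where
  "minkowski_metric p =
     mat p p (\<lambda>(i, j). if i \<noteq> j then 0 else if i = 0 then 1 else - 1)"

definition minkowski_adjoint :: "complex mat \<Rightarrow> complex mat" where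
  "minkowski_adjoint M =
     minkowski_metric (dim_col M) * mat_adjoint M * minkowski_metric (dim_row M)"

definition is_drazin_inverse :: "complex mat \<Rightarrow> complex mat \<Rightarrow> bool" where
  "is_drazin_inverse A X \<longleftrightarrow>
     X \<in> carrier_mat (dim_row A) (dim_row A) \<and>
     X * A * X = X \<and> A * X = X * A \<and>
     A ^\<^sub>m (mat_index A + 1) * X = A ^\<^sub>m (mat_index A)"

definition drazin_inverse :: "complex mat \<Rightarrow> complex mat" where
  "drazin_inverse A = (THE X. is_drazin_inverse A X)"

definition is_minkowski_inverse :: "complex mat \<Rightarrow> complex mat \<Rightarrow> bool" where
  "is_minkowski_inverse A X \<longleftrightarrow>
     X \<in> carrier_mat (dim_col A) (dim_row A) \<and>
     A * X * A = A \<and> X * A * X = X \<and>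
     minkowski_adjoint (A * X) = A * X \<and>
     minkowski_adjoint (X * A) = X * A"

definition minkowski_inverse :: "complex mat \<Rightarrow> complex mat" where
  "minkowski_inverse A = (THE X. is_minkowski_inverse A X)"

definition m_DMP_inverse :: "complex mat \<Rightarrow> complex mat" where
  "m_DMP_inverse A = drazin_inverse A * A * minkowski_inverse A"

definition mat_exp :: "complex mat \<Rightarrow> complex mat" where
  "mat_exp X = mat (dim_row X) (dim_row X)
     (\<lambda>(i, j). \<Sum>k. (X ^\<^sub>m k) $$ (i, j) / fact k)"

text \<open>
  Matrix-valued integrals are taken entrywise. Over \<open>{0..}\<close> the Henstock--Kurzweil integral
  of a continuous function exists exactly when its improper Riemann integral converges
  (possibly only conditionally), and the two then agree. The shape of the integral is read off
  from \<open>f 0\<close>, so it is only meaningful if all \<open>f t\<close> have the same dimensions.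

  Integrability is not automatic for integrands built from \<open>exp (- t B\<^sup>\<sim> B)\<close>, where \<open>B\<^sup>\<sim>\<close> is the
  Minkowski adjoint: as the Minkowski metric is indefinite, \<open>B\<^sup>\<sim> B\<close> can have negative eigenvalues.
  For \<open>B = (0, 1)\<^sup>T\<close> one gets \<open>B\<^sup>\<sim> B = - 1\<close>.
\<close>

definition mat_integrable_on :: "(real \<Rightarrow> complex mat) \<Rightarrow> real set \<Rightarrow> bool" where
  "mat_integrable_on f S \<longleftrightarrow>
     (\<forall>i < dim_row (f 0). \<forall>j < dim_col (f 0). (\<lambda>t. f t $$ (i, j)) integrable_on S)"

definition mat_integral :: "real set \<Rightarrow> (real \<Rightarrow> complex mat) \<Rightarrow> complex mat" where
  "mat_integral S f = mat (dim_row (f 0)) (dim_col (f 0))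
     (\<lambda>(i, j). integral S (\<lambda>t. f t $$ (i, j)))"

text \<open>
  \<open>mat_prod_up B k = B 1 * \<dots> * B k\<close> and \<open>mat_prod_down C k = C k * \<dots> * C 2\<close>. The trailing
  identity matrix gives the empty product the right size.
\<close>

definition mat_prod_up :: "(nat \<Rightarrow> complex mat) \<Rightarrow> nat \<Rightarrow> complex mat" where
  "mat_prod_up B k = foldr (*) (map B [1..<Suc k]) (1\<^sub>m (dim_col (B k)))"

definition mat_prod_down :: "(nat \<Rightarrow> complex mat) \<Rightarrow> nat \<Rightarrow> complex mat" where
  "mat_prod_down C k = foldr (*) (map C (rev [2..<Suc k])) (1\<^sub>m (dim_row (C 1)))"

end

theory Submission
  imports Defs
begin

text \<open>
  Write \<open>M\<^sup>\<sim>\<close> for the Minkowski adjoint, \<open>K = C\<^sub>k B\<^sub>k\<close>, \<open>U = B\<^sub>1 \<cdots> B\<^sub>k\<close>, \<open>V = C\<^sub>k \<cdots> C\<^sub>2\<close> and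
  \<open>N = (B\<^sub>1\<^sup>\<sim> B\<^sub>1)\<^sup>-\<^sup>1\<close>. Both sides of the formula turn out to be \<open>M N B\<^sub>1\<^sup>\<sim>\<close>.

  Algebra. The iterated factorizations telescope to \<open>A\<^sup>k = U (V C\<^sub>1)\<close>, \<open>A U = U K\<close> and
  \<open>V (C\<^sub>1 B\<^sub>1) = K V\<close>, where \<open>U\<close> has a left and \<open>V C\<^sub>1\<close> a right inverse
  (\<open>iterated_full_rank_factorization\<close>). Hence \<open>A\<^sup>k\<close> and \<open>A\<^sup>k\<^sup>+\<^sup>1 = U K (V C\<^sub>1)\<close> have the ranks of the
  identity and of \<open>K\<close>; they agree because \<open>k\<close> is the index of \<open>A\<close>, so \<open>K\<close> is invertible
  (\<open>core_part_invertible\<close>), and \<open>A\<^sup>D = U K\<^sup>-\<^sup>k\<^sup>-\<^sup>1 V C\<^sub>1\<close> (\<open>is_drazin_inverse_compression\<close>).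
  The rank condition on \<open>A\<^sup>\<sim> A A\<^sup>\<sim>\<close> makes \<open>B\<^sub>1\<^sup>\<sim> B\<^sub>1\<close> and \<open>C\<^sub>1 C\<^sub>1\<^sup>\<sim>\<close> invertible
  (\<open>minkowski_gram_inverses\<close>), which gives the Minkowski inverse of \<open>A\<close> as
  \<open>C\<^sub>1\<^sup>\<sim> (C\<^sub>1 C\<^sub>1\<^sup>\<sim>)\<^sup>-\<^sup>1 N B\<^sub>1\<^sup>\<sim>\<close> (\<open>is_minkowski_inverse_full_rank_form\<close>). In the product of \<open>A\<^sup>D\<close>,
  \<open>A\<close> and this matrix, \<open>V C\<^sub>1 B\<^sub>1 = K V\<close> cancels one power of \<open>K\<close> and leaves \<open>M N B\<^sub>1\<^sup>\<sim>\<close>.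

  Analysis. Since the Minkowski metric is indefinite, \<open>exp (- t B\<^sub>1\<^sup>\<sim> B\<^sub>1)\<close> itself need not decay, and
  only convergence of the given integral may be used. As \<open>B\<^sub>1\<^sup>\<sim>\<close> has a right inverse, that
  convergence passes to \<open>h t = M exp (- t B\<^sub>1\<^sup>\<sim> B\<^sub>1)\<close>, and then to its derivative
  \<open>h' t = - h t B\<^sub>1\<^sup>\<sim> B\<^sub>1\<close>. Convergence of the integral of \<open>h'\<close> makes \<open>h\<close> converge at infinity, and
  convergence of the integral of \<open>h\<close> forces its limit to be \<open>0\<close>
  (\<open>integral_derivative_halfline\<close>). Thus \<open>- (\<integral> h) B\<^sub>1\<^sup>\<sim> B\<^sub>1 = \<integral> h' = - M\<close>, that is
  \<open>\<integral> h = M N\<close>.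
\<close>

section \<open>Rank and one-sided inverses\<close>

text \<open>
  Associativity as a rewrite rule: size conditions on the dimension functions, unlike membership in
  \<open>carrier_mat\<close>, leave no intermediate size to be guessed.
\<close>

lemma mult_assoc_dim:
  "dim_col A = dim_row B \<Longrightarrow> dim_col B = dim_row C \<Longrightarrow> (A * B) * C = A * (B * C :: 'a :: semiring_0 mat)"
  by (rule assoc_mult_mat) auto

lemma exists_mat_mult_eq:
  assumes P: "P \<in> carrier_mat n r"
    and cols: "\<And>j. j < m \<Longrightarrow> \<exists>x \<in> carrier_vec r. P *\<^sub>v x = col A j"
    and A: "A \<in> carrier_mat n m"
  obtains Q where "Q \<in> carrier_mat r m" "A = P * (Q :: 'a :: semiring_0 mat)"
proof -
  obtain x where x: "\<And>j. j < m \<Longrightarrow> x j \<in> carrier_vec r \<and> P *\<^sub>v x j = col A j"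
    using cols by metis
  define Q where "Q = mat_of_cols r (map x [0..<m])"
  have Q: "Q \<in> carrier_mat r m" unfolding Q_def by auto
  have colQ: "col Q j = x j" if "j < m" for j
    unfolding Q_def using that x by (subst col_mat_of_cols) auto
  have "A = P * Q"
  proof (rule eq_matI)
    fix i j assume "i < dim_row (P * Q)" "j < dim_col (P * Q)"
    then have i: "i < n" and j: "j < m" using P Q by auto
    have "(P * Q) $$ (i, j) = row P i \<bullet> col Q j" using P Q i j by auto
    also have "\<dots> = (P *\<^sub>v x j) $ i" using P i colQ[OF j] by auto
    also have "\<dots> = A $$ (i, j)" using x[OF j] A i j by auto
    finally show "A $$ (i, j) = (P * Q) $$ (i, j)" ..
  qed (use P Q A in auto)
  with Q show thesis using that by blast
qed

lemma mat_rank_le_dim_col: "mat_rank A \<le> dim_col A"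
  unfolding mat_rank_def by (rule vec_space.rank_le_nc) auto

text \<open>
  The columns of \<open>P\<close> are a maximal independent set of columns of \<open>A\<close>, and the columns of \<open>Q\<close> are
  coordinates with respect to them. Together with \<open>mat_rank_mult_le_inner\<close> below, this makes the rank
  the least inner dimension of a factorization; the inequality for right factors and the invariance
  under transposition follow from that description without further linear algebra.
\<close>

lemma mat_rank_factorization:
  assumes A: "A \<in> carrier_mat n m"
  obtains P Q where "P \<in> carrier_mat n (mat_rank A)" "Q \<in> carrier_mat (mat_rank A) m" "A = P * Q"
proof -
  interpret vec_space "TYPE(complex)" n .
  have colsA: "set (cols A) \<subseteq> carrier_vec n" using A cols_dim by blast
  obtain U where U: "maximal U (\<lambda>T. T \<subseteq> set (cols A) \<and> lin_indpt T)" "finite U"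
    using maximal_exists_superset[of "set (cols A)" "\<lambda>T. T \<subseteq> set (cols A) \<and> lin_indpt T" "{}"]
    by (auto simp: finite_lin_indpt2)
  then have Usub: "U \<subseteq> set (cols A)" and Uind: "lin_indpt U" by (auto simp: maximal_def)
  have card: "mat_rank A = card U"
    using rank_card_indpt[OF A U(1)] A unfolding mat_rank_def by auto
  obtain us where us: "set us = U" "distinct us" using finite_distinct_list[OF U(2)] by auto
  have len: "length us = mat_rank A" using us card distinct_card by fastforce
  define P where "P = mat_of_cols n us"
  have P: "P \<in> carrier_mat n (mat_rank A)" unfolding P_def using len by auto
  have colsP: "set (cols P) = U" unfolding P_def using us Usub colsA by (subst cols_mat_of_cols) auto
  have in_span: "v \<in> span U" if "v \<in> set (cols A)" for v
  proof (cases "v \<in> U")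
    case True
    then show ?thesis using Usub colsA by (meson span_mem subset_trans)
  next
    case False
    have "\<not> lin_indpt (U \<union> {v})"
      using U(1) False that Usub unfolding maximal_def by blast
    then show ?thesis
      using lin_dep_iff_in_span[of U v] Uind Usub colsA that False by auto
  qed
  have "\<exists>x \<in> carrier_vec (mat_rank A). P *\<^sub>v x = col A j" if j: "j < m" for j
  proof -
    have "col A j \<in> set (cols A)" using j A by (auto simp: cols_def)
    then have "col A j \<in> col_space P" unfolding col_space_def colsP by (rule in_span)
    then show ?thesis using col_space_eq[OF P] P by auto
  qed
  then show thesis using exists_mat_mult_eq[OF P _ A] P that by blast
qed

lemma mat_rank_mult_le_left:
  assumes P: "P \<in> carrier_mat n r" and Q: "Q \<in> carrier_mat r m"
  shows "mat_rank (P * Q) \<le> mat_rank P"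
proof -
  interpret vec_space "TYPE(complex)" n .
  have PQ: "P * Q \<in> carrier_mat n m" using P Q by auto
  have cP: "set (cols P) \<subseteq> carrier_vec n" and cPQ: "set (cols (P * Q)) \<subseteq> carrier_vec n"
    using P PQ cols_dim by blast+
  have "col (P * Q) j \<in> span (set (cols P))" if "j < m" for j
  proof -
    have "col (P * Q) j = P *\<^sub>v col Q j" using P Q that by (auto intro!: col_mult2)
    then show ?thesis using col_space_eq[OF P] P Q that unfolding col_space_def by auto
  qed
  then have "set (cols (P * Q)) \<subseteq> span (set (cols P))" using PQ by (auto simp: cols_def)
  then have sub: "span (set (cols (P * Q))) \<subseteq> span (set (cols P))"
    by (rule span_is_subset) (rule span_is_submodule[OF cP])
  have "subspace class_ring (span (set (cols (P * Q)))) (span_vs (set (cols P)))"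
    using nested_subspaces[OF span_is_subspace[OF cP] span_is_subspace[OF cPQ] sub] .
  from vectorspace.subspace_dim[OF subspace_is_vs[OF span_is_subspace[OF cP]] this]
  have "rank (P * Q) \<le> rank P"
    unfolding rank_def using fin_dim_span_cols[OF P] fin_dim_span_cols[OF PQ] by auto
  then show ?thesis using P Q unfolding mat_rank_def by auto
qed

lemma mat_rank_mult_le_inner:
  assumes "P \<in> carrier_mat n r" "Q \<in> carrier_mat r m"
  shows "mat_rank (P * Q) \<le> r"
  using mat_rank_mult_le_left[OF assms] mat_rank_le_dim_col[of P] assms by auto

lemma mat_rank_mult_le_right:
  assumes P: "P \<in> carrier_mat n r" and Q: "Q \<in> carrier_mat r m"
  shows "mat_rank (P * Q) \<le> mat_rank Q"
proof -
  obtain S T where S: "S \<in> carrier_mat r (mat_rank Q)" and T: "T \<in> carrier_mat (mat_rank Q) m"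
    and eq: "Q = S * T" using mat_rank_factorization[OF Q] .
  have "P * Q = (P * S) * T" unfolding eq using P S T by simp
  then show ?thesis using mat_rank_mult_le_inner[of "P * S" n "mat_rank Q" T m] P S T by auto
qed

lemma mat_rank_transpose_le: "mat_rank (transpose_mat A) \<le> mat_rank A"
proof -
  have A: "A \<in> carrier_mat (dim_row A) (dim_col A)" by auto
  obtain P Q where P: "P \<in> carrier_mat (dim_row A) (mat_rank A)"
    and Q: "Q \<in> carrier_mat (mat_rank A) (dim_col A)" and eq: "A = P * Q"
    using mat_rank_factorization[OF A] .
  have "transpose_mat A = transpose_mat Q * transpose_mat P"
    using transpose_mult[OF P Q] eq by simp
  then show ?thesis
    using mat_rank_mult_le_inner[of "transpose_mat Q" _ "mat_rank A" "transpose_mat P"] P Q by auto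
qed

lemma mat_rank_transpose: "mat_rank (transpose_mat A) = mat_rank A"
  using mat_rank_transpose_le[of A] mat_rank_transpose_le[of "transpose_mat A"] by simp

text \<open>
  Independent columns, as many as there are rows, form a basis, so every unit vector is a
  combination of columns; the coefficients are the columns of the right inverse.
\<close>

lemma full_row_rank_right_inverse:
  assumes C: "C \<in> carrier_mat s n" and rank: "mat_rank C = s"
  obtains R where "R \<in> carrier_mat n s" "C * R = 1\<^sub>m s"
proof -
  interpret vec_space "TYPE(complex)" s .
  have colsC: "set (cols C) \<subseteq> carrier_vec s" using C cols_dim by blast
  obtain U where U: "maximal U (\<lambda>T. T \<subseteq> set (cols C) \<and> lin_indpt T)" "finite U"
    using maximal_exists_superset[of "set (cols C)" "\<lambda>T. T \<subseteq> set (cols C) \<and> lin_indpt T" "{}"]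
    by (auto simp: finite_lin_indpt2)
  then have Usub: "U \<subseteq> set (cols C)" and Uind: "lin_indpt U" by (auto simp: maximal_def)
  have "card U = s"
    using rank_card_indpt[OF C U(1)] C rank unfolding mat_rank_def by auto
  then have "basis U"
    using dim_li_is_basis[of U] U(2) Uind Usub colsC dim_is_n by auto
  then have "span U = carrier_vec s" unfolding basis_def by auto
  then have "carrier_vec s \<subseteq> col_space C"
    unfolding col_space_def using span_is_monotone[OF Usub] by auto
  then have units: "unit_vec s j \<in> col_space C" for j by auto
  have "\<exists>x \<in> carrier_vec n. C *\<^sub>v x = col (1\<^sub>m s) j" if "j < s" for j
    using units[of j] that C unfolding col_space_eq[OF C] by auto
  then show thesis using exists_mat_mult_eq[OF C _ one_carrier_mat] that by metis
qed

lemma full_column_rank_left_inverse: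
  assumes B: "B \<in> carrier_mat n s" and rank: "mat_rank B = s"
  obtains L where "L \<in> carrier_mat s n" "L * B = 1\<^sub>m s"
proof -
  obtain R where R: "R \<in> carrier_mat n s" and eq: "transpose_mat B * R = 1\<^sub>m s"
    using full_row_rank_right_inverse[of "transpose_mat B" s n] B rank mat_rank_transpose by auto
  have "transpose_mat R * B = transpose_mat (transpose_mat B * R)"
    using B R by (simp add: transpose_mult[of _ s n _ s])
  then show thesis using that[of "transpose_mat R"] R eq by auto
qed

lemma mat_rank_one: "mat_rank (1\<^sub>m n) = n"
  using vec_space.det_rank_iff[of "1\<^sub>m n :: complex mat" n] unfolding mat_rank_def by simp

lemma full_rank_square_inverse:
  assumes K: "K \<in> carrier_mat s s" and rank: "mat_rank K \<ge> s"
  obtains J where "J \<in> carrier_mat s s" "K * J = 1\<^sub>m s" "J * K = 1\<^sub>m s"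
proof -
  have "mat_rank K = s" using rank mat_rank_le_dim_col[of K] K by auto
  then obtain J where J: "J \<in> carrier_mat s s" "K * J = 1\<^sub>m s"
    using full_row_rank_right_inverse[OF K] by auto
  then show thesis using that mat_mult_left_right_inverse[OF K] by auto
qed

lemma mat_rank_sandwich:
  assumes P: "P \<in> carrier_mat n r" and K: "K \<in> carrier_mat r r" and Q: "Q \<in> carrier_mat r m"
    and L: "L \<in> carrier_mat r n" "L * P = 1\<^sub>m r" and R: "R \<in> carrier_mat m r" "Q * R = 1\<^sub>m r"
  shows "mat_rank (P * K * Q) = mat_rank K"
proof (rule antisym)
  have "mat_rank (P * (K * Q)) \<le> mat_rank (K * Q)"
    using P K Q by (intro mat_rank_mult_le_right) auto
  also have "\<dots> \<le> mat_rank K" using K Q by (intro mat_rank_mult_le_left) auto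
  finally show "mat_rank (P * K * Q) \<le> mat_rank K" using P K Q by simp
  have "K = (L * P) * K * (Q * R)" using L R K by auto
  also have "\<dots> = L * ((P * K * Q) * R)"
    using P K Q L(1) R(1) by (auto simp: mult_assoc_dim)
  finally have "mat_rank K = mat_rank (L * ((P * K * Q) * R))" by simp
  also have "\<dots> \<le> mat_rank ((P * K * Q) * R)"
    using P K Q L(1) R(1) by (intro mat_rank_mult_le_right) auto
  also have "\<dots> \<le> mat_rank (P * K * Q)"
    using P K Q L(1) R(1) by (intro mat_rank_mult_le_left) auto
  finally show "mat_rank K \<le> mat_rank (P * K * Q)" .
qed

lemma mat_inverse_eqI:
  assumes K: "K \<in> carrier_mat s s" and J: "J \<in> carrier_mat s s" "K * J = 1\<^sub>m s" "J * K = 1\<^sub>m s"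
  shows "mat_inverse K = Some (J :: 'a :: field mat)"
proof (cases "mat_inverse K")
  case None
  have "K \<in> Units (ring_mat TYPE('a) s ())"
    using K J unfolding Units_def by (auto simp: ring_mat_simps)
  with mat_inverse(1)[OF K None, of "()"] show ?thesis by blast
next
  case (Some J')
  from mat_inverse(2)[OF K this] have J': "J' * K = 1\<^sub>m s" "J' \<in> carrier_mat s s" by auto
  have "J' = J' * (K * J)" using J J' by simp
  also have "\<dots> = (J' * K) * J" by (rule assoc_mult_mat[symmetric, OF J'(2) K J(1)])
  also have "\<dots> = J" using J J' by simp
  finally show ?thesis using Some by simp
qed

text \<open>
  The number of columns of \<open>B\<close> takes the place of the rank of \<open>M\<close>: in a chain of factorizations
  it is the size shared by consecutive factors.
\<close>

lemma full_rank_factorizationD: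
  assumes "full_rank_factorization M B C"
  shows "B \<in> carrier_mat (dim_row M) (dim_col B)" "C \<in> carrier_mat (dim_col B) (dim_col M)"
    "M = B * C" "mat_rank B = dim_col B" "mat_rank C = dim_col B"
proof -
  have B: "B \<in> carrier_mat (dim_row M) (mat_rank M)" and C: "C \<in> carrier_mat (mat_rank M) (dim_col M)"
    and ranks: "mat_rank B = mat_rank M" "mat_rank C = mat_rank M" and M: "M = B * C"
    using assms unfolding full_rank_factorization_def Let_def by blast+
  note dim = carrier_matD(2)[OF B]
  show "B \<in> carrier_mat (dim_row M) (dim_col B)" "C \<in> carrier_mat (dim_col B) (dim_col M)"
    "mat_rank B = dim_col B" "mat_rank C = dim_col B"
    unfolding dim by (rule B C ranks)+
  show "M = B * C" by (rule M)
qed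

section \<open>The Minkowski inverse in full-rank form\<close>

lemma mat_adjoint_index:
  "i < dim_col A \<Longrightarrow> j < dim_row A \<Longrightarrow> mat_adjoint A $$ (i, j) = cnj (A $$ (j, i))"
  unfolding mat_adjoint_def by (simp add: mat_of_rows_index conjugate_complex_def)

lemma mat_adjoint_dim [simp]:
  "dim_row (mat_adjoint A) = dim_col A" "dim_col (mat_adjoint A) = dim_row A"
  unfolding mat_adjoint_def by auto

lemma mat_adjoint_mult:
  assumes "P \<in> carrier_mat n r" "Q \<in> carrier_mat r m"
  shows "mat_adjoint (P * Q :: complex mat) = mat_adjoint Q * mat_adjoint P"
  using assms
  by (intro eq_matI)
    (auto simp: mat_adjoint_index scalar_prod_def mult.commute intro!: sum.cong)

lemma mat_adjoint_adjoint: "mat_adjoint (mat_adjoint A :: complex mat) = A"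
  by (intro eq_matI) (auto simp: mat_adjoint_index)

lemma minkowski_metric_dim [simp]:
  "dim_row (minkowski_metric p) = p" "dim_col (minkowski_metric p) = p"
  unfolding minkowski_metric_def by auto

lemma mat_adjoint_minkowski_metric: "mat_adjoint (minkowski_metric p) = minkowski_metric p"
  by (intro eq_matI) (auto simp: mat_adjoint_index, auto simp: minkowski_metric_def)

lemma minkowski_metric_involution: "minkowski_metric p * minkowski_metric p = 1\<^sub>m p"
proof (rule eq_matI)
  fix i j assume "i < dim_row (1\<^sub>m p :: complex mat)" "j < dim_col (1\<^sub>m p :: complex mat)"
  then have i: "i < p" and j: "j < p" by auto
  have "(minkowski_metric p * minkowski_metric p) $$ (i, j) =
      (\<Sum>l\<in>{0..<p}. minkowski_metric p $$ (i, l) * minkowski_metric p $$ (l, j))"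
    using i j by (simp add: scalar_prod_def)
  also have "\<dots> = (\<Sum>l\<in>{0..<p}. if l = i then (if i = j then 1 else 0) else 0)"
    using i j by (intro sum.cong) (auto simp: minkowski_metric_def)
  also have "\<dots> = 1\<^sub>m p $$ (i, j)" using i j by (simp add: sum.delta)
  finally show "(minkowski_metric p * minkowski_metric p) $$ (i, j) = 1\<^sub>m p $$ (i, j)" .
qed auto

lemma minkowski_metric_cancel:
  "dim_row X = p \<Longrightarrow> minkowski_metric p * (minkowski_metric p * X) = X"
  using mult_assoc_dim[of "minkowski_metric p" "minkowski_metric p" X]
  by (simp add: minkowski_metric_involution)

lemma minkowski_adjoint_dim [simp]:
  "dim_row (minkowski_adjoint A) = dim_col A" "dim_col (minkowski_adjoint A) = dim_row A"
  unfolding minkowski_adjoint_def by auto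

lemma minkowski_adjoint_carrier [simp]:
  "A \<in> carrier_mat n m \<Longrightarrow> minkowski_adjoint A \<in> carrier_mat m n"
  by auto

lemma minkowski_adjoint_mult:
  assumes "P \<in> carrier_mat n r" "Q \<in> carrier_mat r m"
  shows "minkowski_adjoint (P * Q) = minkowski_adjoint Q * minkowski_adjoint P"
  using assms unfolding minkowski_adjoint_def
  by (simp add: mat_adjoint_mult[OF assms] mult_assoc_dim minkowski_metric_cancel carrier_matD)

lemma minkowski_adjoint_adjoint: "minkowski_adjoint (minkowski_adjoint A) = A"
proof -
  let ?G = minkowski_metric
  have "mat_adjoint (?G (dim_col A) * mat_adjoint A * ?G (dim_row A)) =
      ?G (dim_row A) * (mat_adjoint (?G (dim_col A) * mat_adjoint A))"
    by (subst mat_adjoint_mult) (auto simp: mat_adjoint_minkowski_metric)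
  also have "mat_adjoint (?G (dim_col A) * mat_adjoint A) = A * ?G (dim_col A)"
    by (subst mat_adjoint_mult) (auto simp: mat_adjoint_minkowski_metric mat_adjoint_adjoint)
  finally show ?thesis
    unfolding minkowski_adjoint_def[of "minkowski_adjoint A"]
    unfolding minkowski_adjoint_def
    by (simp add: mult_assoc_dim minkowski_metric_cancel minkowski_metric_involution)
qed

lemma minkowski_adjoint_one: "minkowski_adjoint (1\<^sub>m p) = 1\<^sub>m p"
proof -
  have "mat_adjoint (1\<^sub>m p :: complex mat) = 1\<^sub>m p"
    by (intro eq_matI) (auto simp: mat_adjoint_index)
  then show ?thesis unfolding minkowski_adjoint_def by (simp add: minkowski_metric_involution)
qed

text \<open>
  Penrose's argument: it uses of the adjoint only that it reverses products. Applying it to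
  \<open>A X = (A Y) (A X)\<close> gives \<open>A X = (A X) (A Y) = A Y\<close>, likewise \<open>X A = Y A\<close>, and then
  \<open>X = X A X = X A Y = Y A Y = Y\<close>.
\<close>

lemma is_minkowski_inverse_unique:
  assumes X: "is_minkowski_inverse A X" and Y: "is_minkowski_inverse A Y"
  shows "X = Y"
proof -
  have [simp]: "dim_row X = dim_col A" "dim_col X = dim_row A"
    "dim_row Y = dim_col A" "dim_col Y = dim_row A"
    using X Y unfolding is_minkowski_inverse_def by auto
  from X Y have AXA: "A * (X * A) = A" and XAX: "X * (A * X) = X"
    and AYA: "A * (Y * A) = A" and YAY: "Y * (A * Y) = Y"
    and herm: "minkowski_adjoint (A * X) = A * X" "minkowski_adjoint (X * A) = X * A"
      "minkowski_adjoint (A * Y) = A * Y" "minkowski_adjoint (Y * A) = Y * A"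
    unfolding is_minkowski_inverse_def by (auto simp: mult_assoc_dim)
  have adj: "minkowski_adjoint ((P :: complex mat) * Q) = minkowski_adjoint Q * minkowski_adjoint P"
    if "dim_col P = dim_row Q" for P Q
    using that by (intro minkowski_adjoint_mult[of _ "dim_row P" "dim_col P" _ "dim_col Q"]) auto
  have AX: "A * X = A * Y"
  proof -
    have "A * X = (A * Y) * (A * X)"
      by (subst (1) AYA[symmetric]) (simp add: mult_assoc_dim)
    then have "A * X = minkowski_adjoint ((A * Y) * (A * X))" using herm by simp
    also have "\<dots> = (A * X) * (A * Y)" by (subst adj) (auto simp: herm)
    also have "\<dots> = (A * (X * A)) * Y" by (simp add: mult_assoc_dim)
    finally show ?thesis using AXA by simp
  qed
  have XA: "X * A = Y * A"
  proof -
    have "X * A = (X * A) * (Y * A)"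
      by (subst (1) AYA[symmetric]) (simp add: mult_assoc_dim)
    then have "X * A = minkowski_adjoint ((X * A) * (Y * A))" using herm by simp
    also have "\<dots> = (Y * A) * (X * A)" by (subst adj) (auto simp: herm)
    also have "\<dots> = Y * (A * (X * A))" by (simp add: mult_assoc_dim)
    finally show ?thesis using AXA by simp
  qed
  have "X = X * (A * Y)" using XAX AX by simp
  also have "\<dots> = (X * A) * Y" by (simp add: mult_assoc_dim)
  also have "\<dots> = Y" using XA YAY by (simp add: mult_assoc_dim)
  finally show ?thesis .
qed

lemma minkowski_inverse_eqI: "is_minkowski_inverse A X \<Longrightarrow> minkowski_inverse A = X"
  unfolding minkowski_inverse_def using is_minkowski_inverse_unique by blast

lemma minkowski_adjoint_inverse_selfadjoint:
  assumes K: "K \<in> carrier_mat s s" "minkowski_adjoint K = K"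
    and J: "J \<in> carrier_mat s s" "K * J = 1\<^sub>m s" "J * K = 1\<^sub>m s"
  shows "minkowski_adjoint J = J"
proof -
  have "minkowski_adjoint J * K = minkowski_adjoint (K * J)"
    using minkowski_adjoint_mult[OF K(1) J(1)] K(2) by simp
  then have "minkowski_adjoint J * K = 1\<^sub>m s" using J by (simp add: minkowski_adjoint_one)
  then have "(minkowski_adjoint J * K) * J = J" using J by simp
  then show ?thesis using J K minkowski_adjoint_carrier[OF J(1)] by (simp add: mult_assoc_dim)
qed

text \<open>
  With \<open>X\<close> the claimed inverse, \<open>B C X = B N B\<^sup>\<sim>\<close> and \<open>X B C = C\<^sup>\<sim> H C\<close>. Both are self-adjoint
  because \<open>N\<close> and \<open>H\<close> are inverses of self-adjoint matrices.
\<close>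

lemma is_minkowski_inverse_full_rank_form:
  assumes B: "B \<in> carrier_mat m s" and C: "C \<in> carrier_mat s n"
    and N: "N \<in> carrier_mat s s" "(minkowski_adjoint B * B) * N = 1\<^sub>m s"
      "N * (minkowski_adjoint B * B) = 1\<^sub>m s"
    and H: "H \<in> carrier_mat s s" "(C * minkowski_adjoint C) * H = 1\<^sub>m s"
      "H * (C * minkowski_adjoint C) = 1\<^sub>m s"
  shows "is_minkowski_inverse (B * C) (minkowski_adjoint C * H * N * minkowski_adjoint B)"
proof -
  let ?B' = "minkowski_adjoint B" and ?C' = "minkowski_adjoint C"
  have [simp]: "dim_row B = m" "dim_col B = s" "dim_row C = s" "dim_col C = n"
    "dim_row N = s" "dim_col N = s" "dim_row H = s" "dim_col H = s"
    using B C N H by auto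
  have B': "?B' \<in> carrier_mat s m" and C': "?C' \<in> carrier_mat n s" using B C by auto
  have BB: "?B' * (B * (N * Z)) = Z" if "dim_row Z = s" for Z
  proof -
    have "?B' * (B * (N * Z)) = ((?B' * B) * N) * Z" using that by (simp add: mult_assoc_dim)
    then show ?thesis using N that by simp
  qed
  have BB2: "N * (?B' * (B * Z)) = Z" if "dim_row Z = s" for Z
  proof -
    have "N * (?B' * (B * Z)) = (N * (?B' * B)) * Z" using that by (simp add: mult_assoc_dim)
    then show ?thesis using N that by simp
  qed
  have CC: "C * (?C' * (H * Z)) = Z" if "dim_row Z = s" for Z
  proof -
    have "C * (?C' * (H * Z)) = ((C * ?C') * H) * Z" using that by (simp add: mult_assoc_dim)
    then show ?thesis using H that by simp
  qed
  let ?X = "?C' * H * N * ?B'"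
  have AX: "B * C * ?X = B * N * ?B'"
    by (simp add: mult_assoc_dim CC)
  have XA: "?X * (B * C) = ?C' * H * C"
    by (simp add: mult_assoc_dim BB2)
  have selfN: "minkowski_adjoint N = N"
    by (rule minkowski_adjoint_inverse_selfadjoint[OF _ _ N])
      (use B B' in \<open>auto simp: minkowski_adjoint_mult[OF B' B] minkowski_adjoint_adjoint\<close>)
  have selfH: "minkowski_adjoint H = H"
    by (rule minkowski_adjoint_inverse_selfadjoint[OF _ _ H])
      (use C C' in \<open>auto simp: minkowski_adjoint_mult[OF C C'] minkowski_adjoint_adjoint\<close>)
  have "minkowski_adjoint (B * N * ?B') = B * N * ?B'"
    using minkowski_adjoint_mult[OF mult_carrier_mat[OF B N(1)] B']
      minkowski_adjoint_mult[OF B N(1)]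
    by (simp add: minkowski_adjoint_adjoint selfN mult_assoc_dim)
  moreover have "minkowski_adjoint (?C' * H * C) = ?C' * H * C"
    using minkowski_adjoint_mult[OF mult_carrier_mat[OF C' H(1)] C]
      minkowski_adjoint_mult[OF C' H(1)]
    by (simp add: minkowski_adjoint_adjoint selfH mult_assoc_dim)
  moreover have "B * C * ?X * (B * C) = B * C"
    unfolding AX by (simp add: mult_assoc_dim BB2)
  moreover have "?X * (B * C) * ?X = ?X"
    unfolding XA by (simp add: mult_assoc_dim CC)
  ultimately show ?thesis
    unfolding is_minkowski_inverse_def AX XA by auto
qed

text \<open>
  In \<open>(B C)\<^sup>\<sim> (B C) (B C)\<^sup>\<sim> = C\<^sup>\<sim> (B\<^sup>\<sim> B) (C C\<^sup>\<sim>) B\<^sup>\<sim>\<close> both middle factors have size \<open>s\<close>, so a product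
  of rank at least \<open>s\<close> leaves them no room to be singular. For an indefinite metric this is a genuine
  condition, since \<open>B\<^sup>\<sim> B\<close> can be singular even if \<open>B\<close> has full column rank.
\<close>

lemma minkowski_gram_inverses:
  assumes B: "B \<in> carrier_mat m s" and C: "C \<in> carrier_mat s n"
    and rank: "mat_rank (minkowski_adjoint (B * C) * (B * C) * minkowski_adjoint (B * C)) \<ge> s"
  obtains N H where "N \<in> carrier_mat s s" "(minkowski_adjoint B * B) * N = 1\<^sub>m s"
      "N * (minkowski_adjoint B * B) = 1\<^sub>m s"
    and "H \<in> carrier_mat s s" "(C * minkowski_adjoint C) * H = 1\<^sub>m s"
      "H * (C * minkowski_adjoint C) = 1\<^sub>m s"
proof -
  let ?B' = "minkowski_adjoint B" and ?C' = "minkowski_adjoint C"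
  have B': "?B' \<in> carrier_mat s m" and C': "?C' \<in> carrier_mat n s" using B C by auto
  have [simp]: "dim_row B = m" "dim_col B = s" "dim_row C = s" "dim_col C = n" using B C by auto
  have BB: "?B' * B \<in> carrier_mat s s" and CC: "C * ?C' \<in> carrier_mat s s"
    using mult_carrier_mat[OF B' B] mult_carrier_mat[OF C C'] .
  note CCB = mult_carrier_mat[OF CC B']
  have "minkowski_adjoint (B * C) * (B * C) * minkowski_adjoint (B * C) =
      ?C' * ((?B' * B) * ((C * ?C') * ?B'))"
    unfolding minkowski_adjoint_mult[OF B C] by (simp add: mult_assoc_dim)
  with rank have "s \<le> mat_rank (?C' * ((?B' * B) * ((C * ?C') * ?B')))" by simp
  also have "\<dots> \<le> mat_rank ((?B' * B) * ((C * ?C') * ?B'))"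
    by (rule mat_rank_mult_le_right[OF C' mult_carrier_mat[OF BB CCB]])
  finally have le: "s \<le> mat_rank ((?B' * B) * ((C * ?C') * ?B'))" .
  have "s \<le> mat_rank (?B' * B)"
    using le mat_rank_mult_le_left[OF BB CCB] by (rule order_trans)
  moreover have "s \<le> mat_rank (C * ?C')"
    using le mat_rank_mult_le_right[OF BB CCB] mat_rank_mult_le_left[OF CC B']
    by (meson order_trans)
  ultimately show thesis
    using that full_rank_square_inverse[OF BB] full_rank_square_inverse[OF CC] by metis
qed

section \<open>The Drazin inverse of a compressed matrix\<close>

lemma pow_mat_Suc_left:
  assumes "A \<in> carrier_mat n n"
  shows "A ^\<^sub>m Suc k = A * A ^\<^sub>m k"
proof (induction k)
  case (Suc k)
  have "A ^\<^sub>m Suc (Suc k) = (A * A ^\<^sub>m k) * A" using Suc by simp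
  also have "\<dots> = A * A ^\<^sub>m Suc k" using assms by (simp add: mult_assoc_dim)
  finally show ?case .
qed (use assms in auto)

lemma pow_mat_intertwine:
  assumes A: "A \<in> carrier_mat n n" and K: "K \<in> carrier_mat r r" and U: "U \<in> carrier_mat n r"
    and AU: "A * U = U * K"
  shows "A ^\<^sub>m k * U = U * K ^\<^sub>m k"
proof (induction k)
  case (Suc k)
  have "A ^\<^sub>m Suc k * U = A ^\<^sub>m k * (A * U)" using A U by (simp add: mult_assoc_dim)
  also have "\<dots> = (A ^\<^sub>m k * U) * K" using A U K by (simp add: AU mult_assoc_dim)
  also have "\<dots> = U * K ^\<^sub>m Suc k" using Suc U K by (simp add: mult_assoc_dim)
  finally show ?case .
qed (use A U K in auto)

lemma pow_mat_inverse:
  assumes K: "K \<in> carrier_mat r r" and J: "J \<in> carrier_mat r r" and KJ: "K * J = 1\<^sub>m r"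
  shows "K ^\<^sub>m m * J ^\<^sub>m m = 1\<^sub>m r"
proof (induction m)
  case (Suc m)
  have "K ^\<^sub>m Suc m * J ^\<^sub>m Suc m = K ^\<^sub>m m * ((K * J) * J ^\<^sub>m m)"
    using K J by (simp only: pow_mat_Suc_left[OF J]) (simp add: mult_assoc_dim)
  then show ?case using Suc K J KJ by simp
qed (use K J in simp)

text \<open>
  Iterating \<open>X = X A X\<close> and \<open>Y = Y A Y\<close> gives \<open>X = X\<^sup>k\<^sup>+\<^sup>1 A\<^sup>k\<close> and \<open>Y = A\<^sup>k Y\<^sup>k\<^sup>+\<^sup>1\<close>. Replacing \<open>A\<^sup>k\<close> by
  \<open>A\<^sup>k\<^sup>+\<^sup>1 Y\<close> in the first and by \<open>X A\<^sup>k\<^sup>+\<^sup>1\<close> in the second turns both into \<open>X A Y\<close>.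
\<close>

lemma is_drazin_inverse_unique:
  assumes A: "A \<in> carrier_mat n n"
    and X: "is_drazin_inverse A X" and Y: "is_drazin_inverse A Y"
  shows "X = Y"
proof -
  define k where "k = mat_index A"
  have Xc: "X \<in> carrier_mat n n" and Yc: "Y \<in> carrier_mat n n"
    using A X Y unfolding is_drazin_inverse_def by auto
  have [simp]: "dim_row A = n" "dim_col A = n" "dim_row X = n" "dim_col X = n"
    "dim_row Y = n" "dim_col Y = n"
    using A Xc Yc by auto
  from X have XAX: "X * (A * X) = X" and AX: "A * X = X * A"
    and AkX: "A ^\<^sub>m Suc k * X = A ^\<^sub>m k"
    unfolding is_drazin_inverse_def k_def by (auto simp: mult_assoc_dim)
  from Y have YAY: "Y * (A * Y) = Y" and AY: "A * Y = Y * A"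
    and AkY: "A ^\<^sub>m Suc k * Y = A ^\<^sub>m k"
    unfolding is_drazin_inverse_def k_def by (auto simp: mult_assoc_dim)
  have powX: "X ^\<^sub>m Suc m * A ^\<^sub>m m = X" for m
  proof (induction m)
    case (Suc m)
    have "X ^\<^sub>m Suc (Suc m) * A ^\<^sub>m Suc m = X * ((X ^\<^sub>m Suc m * A ^\<^sub>m m) * A)"
      using A Xc by (simp only: pow_mat_Suc_left[OF Xc, of "Suc m"])
        (simp add: mult_assoc_dim)
    also have "\<dots> = X * (X * A)" using Suc by simp
    finally show ?case using XAX AX by simp
  qed (use A Xc in simp)
  have powY: "A ^\<^sub>m m * Y ^\<^sub>m Suc m = Y" for m
  proof (induction m)
    case (Suc m)
    have "A ^\<^sub>m Suc m * Y ^\<^sub>m Suc (Suc m) = A * ((A ^\<^sub>m m * Y ^\<^sub>m Suc m) * Y)"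
      using A Yc by (simp only: pow_mat_Suc_left[OF A, of m])
        (simp add: mult_assoc_dim)
    also have "\<dots> = (A * Y) * Y" using Suc by (simp add: mult_assoc_dim)
    also have "\<dots> = (Y * A) * Y" by (simp only: AY)
    finally show ?case using YAY by (simp add: mult_assoc_dim)
  qed (use A Yc in simp)
  have "X = X ^\<^sub>m Suc k * (A ^\<^sub>m Suc k * Y)" using powX[of k] AkY by simp
  also have "\<dots> = (X ^\<^sub>m Suc k * A ^\<^sub>m k) * (A * Y)" by (simp add: mult_assoc_dim)
  finally have X_eq: "X = X * (A * Y)" using powX[of k] by simp
  have "A ^\<^sub>m Suc k * X = X * A ^\<^sub>m Suc k"
    using pow_mat_intertwine[OF A A Xc AX] .
  then have "Y = (X * A ^\<^sub>m Suc k) * Y ^\<^sub>m Suc k" using powY[of k] AkX by simp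
  also have "\<dots> = X * (A * (A ^\<^sub>m k * Y ^\<^sub>m Suc k))"
    by (simp only: pow_mat_Suc_left[OF A, of k]) (simp add: mult_assoc_dim)
  finally have "Y = X * (A * Y)" using powY[of k] by simp
  with X_eq show ?thesis by simp
qed

lemma drazin_inverse_eqI:
  assumes "A \<in> carrier_mat n n" "is_drazin_inverse A X"
  shows "drazin_inverse A = X"
  unfolding drazin_inverse_def using assms is_drazin_inverse_unique[OF assms(1)] by blast

text \<open>
  The matrix \<open>K\<close> is \<open>A\<close> acting on the range of \<open>A\<^sup>k\<close>, in the coordinates given by \<open>U\<close>. Intertwining
  and cancelling \<open>U\<close> show \<open>W U = K\<^sup>k\<close>, and this identity reduces the Drazin equations to cancellations
  of powers of \<open>K\<close> against powers of its inverse \<open>J\<close>.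
\<close>

lemma is_drazin_inverse_compression:
  assumes k: "k = mat_index A" and A: "A \<in> carrier_mat n n" and U: "U \<in> carrier_mat n r" and W: "W \<in> carrier_mat r n"
    and K: "K \<in> carrier_mat r r"
    and L: "L \<in> carrier_mat r n" "L * U = 1\<^sub>m r"
    and AU: "A * U = U * K" and WA: "W * A = K * W" and Ak: "A ^\<^sub>m k = U * W"
    and J: "J \<in> carrier_mat r r" "K * J = 1\<^sub>m r" "J * K = 1\<^sub>m r"
  shows "is_drazin_inverse A (U * J ^\<^sub>m Suc k * W)"
proof -
  have [simp]: "dim_row A = n" "dim_col A = n" "dim_row U = n" "dim_col U = r"
    "dim_row W = r" "dim_col W = n" "dim_row K = r" "dim_col K = r"
    "dim_row J = r" "dim_col J = r" "dim_row L = r" "dim_col L = n"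
    using A U W K L(1) J(1) by auto
  define P where "P = J ^\<^sub>m Suc k"
  have P: "P \<in> carrier_mat r r" unfolding P_def by (rule pow_carrier_mat[OF J(1)])
  have [simp]: "dim_row P = r" "dim_col P = r" using P by auto
  have WU: "W * U = K ^\<^sub>m k"
  proof -
    have "U * (W * U) = A ^\<^sub>m k * U" by (simp add: Ak mult_assoc_dim)
    also have "\<dots> = U * K ^\<^sub>m k" by (rule pow_mat_intertwine[OF A K U AU])
    finally have "L * (U * (W * U)) = L * (U * K ^\<^sub>m k)" by simp
    then have "(L * U) * (W * U) = (L * U) * K ^\<^sub>m k" by (simp add: mult_assoc_dim)
    moreover have "W * U \<in> carrier_mat r r" by (rule mult_carrier_mat[OF W U])
    ultimately show ?thesis unfolding L(2) using pow_carrier_mat[OF K] by simp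
  qed
  have PK: "P * K ^\<^sub>m Suc k = 1\<^sub>m r"
    unfolding P_def using pow_mat_inverse[OF J(1) K J(3)] .
  have KP: "K ^\<^sub>m Suc k * P = 1\<^sub>m r"
    unfolding P_def using pow_mat_inverse[OF K J(1,2)] .
  have comm: "P * K = K * P"
    unfolding P_def by (rule pow_mat_intertwine[OF J(1) J(1) K]) (simp only: J(2,3))
  have AX: "A * (U * P * W) = U * (K * P) * W"
  proof -
    have "A * (U * P * W) = (A * U) * P * W" by (simp add: mult_assoc_dim)
    then show ?thesis unfolding AU by (simp add: mult_assoc_dim)
  qed
  have XA: "(U * P * W) * A = U * (P * K) * W"
  proof -
    have "(U * P * W) * A = U * P * (W * A)" by (simp add: mult_assoc_dim)
    then show ?thesis unfolding WA by (simp add: mult_assoc_dim)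
  qed
  have "(U * P * W) * A * (U * P * W) = U * ((P * (K * (W * U))) * P) * W"
    unfolding XA by (simp add: mult_assoc_dim)
  also have "K * (W * U) = K ^\<^sub>m Suc k" unfolding WU pow_mat_Suc_left[OF K] ..
  finally have XAX: "(U * P * W) * A * (U * P * W) = U * P * W"
    unfolding PK using P by simp
  have [simp]: "dim_row (Z ^\<^sub>m Suc k) = d" "dim_col (Z ^\<^sub>m Suc k) = d"
    if "Z \<in> carrier_mat d d" for Z :: "complex mat" and d
    using pow_carrier_mat[OF that, of "Suc k"] by auto
  have "A ^\<^sub>m Suc k * (U * P * W) = (A ^\<^sub>m Suc k * U) * P * W"
    using A by (simp del: pow_mat.simps add: mult_assoc_dim)
  also have "\<dots> = U * (K ^\<^sub>m Suc k * P) * W"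
    unfolding pow_mat_intertwine[OF A K U AU] using K by (simp del: pow_mat.simps add: mult_assoc_dim)
  also have "\<dots> = A ^\<^sub>m k" unfolding KP Ak using U by simp
  finally have "A ^\<^sub>m Suc k * (U * P * W) = A ^\<^sub>m k" .
  moreover have "U * P * W \<in> carrier_mat n n" by (auto intro!: carrier_matI)
  ultimately show ?thesis
    unfolding is_drazin_inverse_def using XAX AX XA comm
    by (simp del: pow_mat.simps flip: P_def k)
qed

lemma mat_rank_pow_Suc_le:
  assumes A: "A \<in> carrier_mat n n"
  shows "mat_rank (A ^\<^sub>m Suc k) \<le> mat_rank (A ^\<^sub>m k)"
  using mat_rank_mult_le_left[OF pow_carrier_mat[OF A] A] by simp

text \<open>
  The index is a least number, so the equation needs a witness: a power of minimal rank, at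
  which the nonincreasing sequence of ranks cannot drop further.
\<close>

lemma mat_rank_pow_index:
  assumes A: "A \<in> carrier_mat n n"
  shows "mat_rank (A ^\<^sub>m Suc (mat_index A)) = mat_rank (A ^\<^sub>m mat_index A)"
proof -
  obtain k where min: "\<And>m. mat_rank (A ^\<^sub>m k) \<le> mat_rank (A ^\<^sub>m m)"
    using ex_has_least_nat[of "\<lambda>_. True" 0 "\<lambda>k. mat_rank (A ^\<^sub>m k)"] by auto
  have "mat_rank (A ^\<^sub>m (k + 1)) = mat_rank (A ^\<^sub>m k)"
    using le_antisym[OF mat_rank_pow_Suc_le[OF A, of k] min[of "Suc k"]] by simp
  then show ?thesis
    using LeastI[of "\<lambda>k. mat_rank (A ^\<^sub>m (k + 1)) = mat_rank (A ^\<^sub>m k)" k]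
    unfolding mat_index_def Suc_eq_plus1 by blast
qed

text \<open>
  Sandwiched between \<open>U\<close> and \<open>W\<close>, the identity gives \<open>A\<^sup>k\<close> and \<open>K\<close> gives \<open>A\<^sup>k\<^sup>+\<^sup>1\<close>. Their ranks agree at
  the index, so \<open>K\<close> has full rank.
\<close>

lemma core_part_invertible:
  assumes A: "A \<in> carrier_mat n n" and k: "k = mat_index A"
    and U: "U \<in> carrier_mat n r" and W: "W \<in> carrier_mat r n" and K: "K \<in> carrier_mat r r"
    and L: "L \<in> carrier_mat r n" "L * U = 1\<^sub>m r" and R: "R \<in> carrier_mat n r" "W * R = 1\<^sub>m r"
    and AU: "A * U = U * K" and Ak: "A ^\<^sub>m k = U * W"
  obtains J where "J \<in> carrier_mat r r" "K * J = 1\<^sub>m r" "J * K = 1\<^sub>m r"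
proof -
  have "A ^\<^sub>m Suc k = A * (U * W)" unfolding pow_mat_Suc_left[OF A] Ak ..
  also have "\<dots> = (A * U) * W" by (rule assoc_mult_mat[OF A U W, symmetric])
  finally have "mat_rank (A ^\<^sub>m Suc k) = mat_rank K"
    unfolding AU using mat_rank_sandwich[OF U K W L R] by (simp only:)
  moreover have "mat_rank (A ^\<^sub>m k) = mat_rank (1\<^sub>m r)"
    using mat_rank_sandwich[OF U one_carrier_mat W L R] U unfolding Ak by simp
  ultimately have "mat_rank K = r"
    using mat_rank_pow_index[OF A] unfolding k mat_rank_one by metis
  then show thesis using full_rank_square_inverse[OF K] that by auto
qed

section \<open>Iterated full-rank factorizations\<close>

lemma mat_prod_up_Suc:
  assumes dims: "\<And>i. 1 \<le> i \<Longrightarrow> i < Suc k \<Longrightarrow> dim_col (B i) = dim_row (B (Suc i))" and k: "k \<ge> 1"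
  shows "mat_prod_up B (Suc k) = mat_prod_up B k * B (Suc k)
    \<and> dim_row (mat_prod_up B k) = dim_row (B 1) \<and> dim_col (mat_prod_up B k) = dim_col (B k)"
proof -
  \<comment> \<open>The induction removes factors from the left, hence the variable start \<open>m\<close> of the product.\<close>
  have gen: "foldr (*) (map B [m..<Suc k]) Z = foldr (*) (map B [m..<Suc k]) (1\<^sub>m (dim_col (B k))) * Z
     \<and> dim_row (foldr (*) (map B [m..<Suc k]) (1\<^sub>m (dim_col (B k)))) = dim_row (B m)
     \<and> dim_col (foldr (*) (map B [m..<Suc k]) (1\<^sub>m (dim_col (B k)))) = dim_col (B k)"
    if "m \<le> k" "1 \<le> m" and Z: "dim_row Z = dim_col (B k)" for m Z
    using that(1,2)
  proof (induction m rule: inc_induct)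
    case base
    then show ?case using Z by (simp add: mult_assoc_dim)
  next
    case (step m)
    have split: "[m..<Suc k] = m # [Suc m..<Suc k]" using step.hyps by (simp add: upt_conv_Cons)
    show ?case using step.IH step.prems step.hyps dims[of m] Z
      unfolding split by (simp add: mult_assoc_dim)
  qed
  have "mat_prod_up B (Suc k) = foldr (*) (map B [1..<Suc k]) (B (Suc k))"
    unfolding mat_prod_up_def by simp
  also have "\<dots> = mat_prod_up B k * B (Suc k)"
    unfolding mat_prod_up_def using gen[of 1 "B (Suc k)"] dims[of k] k by auto
  finally show ?thesis using gen[of 1 "B (Suc k)"] dims[of k] k unfolding mat_prod_up_def by auto
qed

lemma mat_prod_down_Suc:
  assumes "k \<ge> 1"
  shows "mat_prod_down C (Suc k) = C (Suc k) * mat_prod_down C k"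
proof -
  have "[2..<Suc (Suc k)] = [2..<Suc k] @ [Suc k]"
    using assms by (intro upt_Suc_append) simp
  then show ?thesis unfolding mat_prod_down_def by (simp only:) (simp del: upt_Suc)
qed

text \<open>
  All claims are proved by one induction on the number of factors. Each step replaces
  \<open>C\<^sub>m B\<^sub>m\<close> by \<open>B\<^sub>m\<^sub>+\<^sub>1 C\<^sub>m\<^sub>+\<^sub>1\<close>, as in \<open>A\<^sup>m\<^sup>+\<^sup>1 = A U V C\<^sub>1 = U (C\<^sub>m B\<^sub>m) V C\<^sub>1 = (U B\<^sub>m\<^sub>+\<^sub>1) (C\<^sub>m\<^sub>+\<^sub>1 V) C\<^sub>1\<close>.
\<close>

lemma iterated_full_rank_factorization:
  assumes k: "1 \<le> k"
    and first: "full_rank_factorization A (B 1) (C 1)" and A: "A \<in> carrier_mat n n"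
    and factor: "\<And>i. 1 \<le> i \<Longrightarrow> i < k \<Longrightarrow>
      full_rank_factorization (C i * B i) (B (Suc i)) (C (Suc i))"
  defines "U \<equiv> mat_prod_up B k" and "V \<equiv> mat_prod_down C k"
    and "r \<equiv> dim_col (B k)" and "s \<equiv> dim_col (B 1)"
  shows "U \<in> carrier_mat n r" "V \<in> carrier_mat r s" "C k \<in> carrier_mat r (dim_row (B k))"
    "A * U = U * (C k * B k)" "V * (C 1 * B 1) = (C k * B k) * V" "A ^\<^sub>m k = U * (V * C 1)"
    "\<exists>L. L \<in> carrier_mat r n \<and> L * U = 1\<^sub>m r"
    "\<exists>R. R \<in> carrier_mat n r \<and> (V * C 1) * R = 1\<^sub>m r"
proof -
  note D1 = full_rank_factorizationD[OF first]
  have B1: "B 1 \<in> carrier_mat n s" and C1: "C 1 \<in> carrier_mat s n" and A_eq: "A = B 1 * C 1"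
    using D1(1-3) unfolding s_def carrier_matD[OF A] .
  define P where "P m \<longleftrightarrow>
    mat_prod_up B m \<in> carrier_mat n (dim_col (B m)) \<and> mat_prod_down C m \<in> carrier_mat (dim_col (B m)) s \<and>
    C m \<in> carrier_mat (dim_col (B m)) (dim_row (B m)) \<and>
    A * mat_prod_up B m = mat_prod_up B m * (C m * B m) \<and>
    mat_prod_down C m * (C 1 * B 1) = (C m * B m) * mat_prod_down C m \<and>
    A ^\<^sub>m m = mat_prod_up B m * (mat_prod_down C m * C 1) \<and>
    (\<exists>L. L \<in> carrier_mat (dim_col (B m)) n \<and> L * mat_prod_up B m = 1\<^sub>m (dim_col (B m))) \<and>
    (\<exists>R. R \<in> carrier_mat n (dim_col (B m)) \<and> (mat_prod_down C m * C 1) * R = 1\<^sub>m (dim_col (B m)))" for m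
  have dims: "dim_row (B (Suc i)) = dim_col (B i)" if i: "1 \<le> i" "i < k" for i
  proof -
    have "dim_row (C i) = dim_col (B i)"
    proof (cases "i = 1")
      case False
      then obtain j where j: "i = Suc j" "1 \<le> j" using i by (cases i) auto
      then show ?thesis using full_rank_factorizationD(2)[OF factor[of j]] i by auto
    qed (use C1 s_def in auto)
    then show ?thesis using full_rank_factorizationD(1)[OF factor[OF i]] by auto
  qed
  have "P k" using k
  proof (induction rule: dec_induct)
    case base
    have up: "mat_prod_up B 1 = B 1" unfolding mat_prod_up_def by simp
    have down: "mat_prod_down C 1 = 1\<^sub>m s" unfolding mat_prod_down_def using C1 by simp
    obtain L where "L \<in> carrier_mat s n" "L * B 1 = 1\<^sub>m s"
      using full_column_rank_left_inverse[OF B1] D1(4) unfolding s_def by auto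
    moreover obtain R where "R \<in> carrier_mat n s" "C 1 * R = 1\<^sub>m s"
      using full_row_rank_right_inverse[OF C1] D1(5) unfolding s_def by auto
    moreover have "B 1 * C 1 * B 1 = B 1 * (C 1 * B 1)" using B1 C1 by simp
    moreover have "dim_row (B 1) = n" "dim_col (B 1) = s" using B1 by auto
    ultimately show ?case
      unfolding P_def up down A_eq using B1 C1 by auto
  next
    case (step m)
    \<comment> \<open>\<open>C 1\<close> and \<open>B 1\<close> must stay as they are for the size facts below to apply to them.\<close>
    note One_nat_def [simp del]
    define r where "r = dim_col (B m)"
    define r' where "r' = dim_col (B (Suc m))"
    define U where "U = mat_prod_up B m"
    define V where "V = mat_prod_down C m"
    define B' where "B' = B (Suc m)"
    define C' where "C' = C (Suc m)"
    from step.IH step.hyps step.prems have IH: "P m" by simp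
    then have U: "U \<in> carrier_mat n r" and V: "V \<in> carrier_mat r s"
      and Cm: "C m \<in> carrier_mat r (dim_row (B m))"
      and AU: "A * U = U * (C m * B m)" and VK: "V * (C 1 * B 1) = (C m * B m) * V"
      and Am: "A ^\<^sub>m m = U * (V * C 1)"
      unfolding P_def U_def V_def r_def by blast+
    obtain L where L: "L \<in> carrier_mat r n" "L * U = 1\<^sub>m r"
      using IH unfolding P_def U_def r_def by blast
    obtain R where R: "R \<in> carrier_mat n r" "(V * C 1) * R = 1\<^sub>m r"
      using IH unfolding P_def V_def r_def by blast
    note D = full_rank_factorizationD[OF factor[OF step.hyps(1)]]
    have m: "m < k" using step by simp
    have prod_dim: "dim_row (C m * B m) = r" "dim_col (C m * B m) = r"
      using Cm unfolding r_def by auto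
    have B': "B' \<in> carrier_mat r r'" and C': "C' \<in> carrier_mat r' r"
      and K: "C m * B m = B' * C'"
      using D(1-3)[OF m] unfolding prod_dim B'_def C'_def r'_def .
    obtain L' where L': "L' \<in> carrier_mat r' r" "L' * B' = 1\<^sub>m r'"
      using full_column_rank_left_inverse[OF B'] D(4)[OF m] unfolding B'_def r'_def by auto
    obtain R' where R': "R' \<in> carrier_mat r r'" "C' * R' = 1\<^sub>m r'"
      using full_row_rank_right_inverse[OF C'] D(5)[OF m] unfolding C'_def r'_def by auto
    have [simp]: "dim_row A = n" "dim_col A = n" "dim_row U = n" "dim_col U = r"
      "dim_row V = r" "dim_col V = s" "dim_row B' = r" "dim_col B' = r'"
      "dim_row C' = r'" "dim_col C' = r" "dim_row (C 1) = s" "dim_col (C 1) = n"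
      "dim_row (B 1) = n" "dim_col (B 1) = s" "dim_row L = r" "dim_col L = n"
      "dim_row R = n" "dim_col R = r" "dim_row L' = r'" "dim_col L' = r"
      "dim_row R' = r" "dim_col R' = r'"
      using A U V B' C' B1 C1 L(1) R(1) L'(1) R'(1) by auto
    have up: "mat_prod_up B (Suc m) = U * B'"
      unfolding U_def B'_def using step.hyps m
      by (intro conjunct1[OF mat_prod_up_Suc]) (auto simp: dims)
    have down: "mat_prod_down C (Suc m) = C' * V"
      unfolding V_def C'_def using step.hyps by (intro mat_prod_down_Suc) simp
    have AU': "A * (U * B') = (U * B') * (C' * B')"
    proof -
      have "A * (U * B') = (A * U) * B'" by (rule mult_assoc_dim[symmetric]) auto
      then show ?thesis unfolding AU K by (simp add: mult_assoc_dim)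
    qed
    have VK': "(C' * V) * (C 1 * B 1) = (C' * B') * (C' * V)"
    proof -
      have "(C' * V) * (C 1 * B 1) = C' * (V * (C 1 * B 1))" by (rule mult_assoc_dim) auto
      then show ?thesis unfolding VK K by (simp add: mult_assoc_dim)
    qed
    have pow: "A ^\<^sub>m Suc m = (U * B') * ((C' * V) * C 1)"
    proof -
      have "A ^\<^sub>m Suc m = (A * U) * (V * C 1)"
        unfolding pow_mat_Suc_left[OF A] Am by (rule mult_assoc_dim[symmetric]) auto
      then show ?thesis unfolding AU K by (simp add: mult_assoc_dim)
    qed
    have left: "(L' * L) * (U * B') = 1\<^sub>m r'"
    proof -
      have "(L' * L) * (U * B') = L' * ((L * U) * B')" by (simp add: mult_assoc_dim)
      then show ?thesis using L L' B' by simp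
    qed
    have right: "((C' * V) * C 1) * (R * R') = 1\<^sub>m r'"
    proof -
      have "((C' * V) * C 1) * (R * R') = C' * (((V * C 1) * R) * R')" by (simp add: mult_assoc_dim)
      then show ?thesis using R R' C' by simp
    qed
    have carriers: "L' * L \<in> carrier_mat r' n" "R * R' \<in> carrier_mat n r'"
      "U * B' \<in> carrier_mat n r'" "C' * V \<in> carrier_mat r' s" "C' \<in> carrier_mat r' (dim_row B')"
      by (auto intro!: carrier_matI)
    show ?case
      unfolding P_def r'_def[symmetric] unfolding up down B'_def[symmetric] C'_def[symmetric]
      by (intro conjI carriers AU' VK' pow)
        (rule exI, rule conjI, rule carriers(1), rule left,
          rule exI, rule conjI, rule carriers(2), rule right)
  qed
  then show "U \<in> carrier_mat n r" "V \<in> carrier_mat r s" "C k \<in> carrier_mat r (dim_row (B k))"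
    "A * U = U * (C k * B k)" "V * (C 1 * B 1) = (C k * B k) * V" "A ^\<^sub>m k = U * (V * C 1)"
    "\<exists>L. L \<in> carrier_mat r n \<and> L * U = 1\<^sub>m r"
    "\<exists>R. R \<in> carrier_mat n r \<and> (V * C 1) * R = 1\<^sub>m r"
    unfolding P_def U_def V_def r_def s_def by blast+
qed

section \<open>Integrals of matrix exponentials over the half-line\<close>

text \<open>
  The Henstock--Kurzweil integral over an unbounded set is a limit over large boxes, so this holds
  for conditionally convergent integrals as well.
\<close>

lemma tendsto_integral_halfline:
  fixes f :: "real \<Rightarrow> 'a :: banach"
  assumes f: "f integrable_on {0..}"
  shows "((\<lambda>T. integral {0..T} f) \<longlongrightarrow> integral {0..} f) at_top"
proof (rule tendstoI)
  fix e :: real assume e: "e > 0"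
  obtain B where B: "B > 0" "\<And>a b. ball 0 B \<subseteq> cbox a b \<Longrightarrow>
      norm (integral (cbox a b) (\<lambda>x. if x \<in> {0..} then f x else 0) - integral {0..} f) < e"
    using integrable_integral[OF f] e unfolding has_integral_alt'[of f] by blast
  show "\<forall>\<^sub>F T in at_top. dist (integral {0..T} f) (integral {0..} f) < e"
    using eventually_ge_at_top[of B]
  proof eventually_elim
    case (elim T)
    have "{0..} \<inter> {-T..T} = {0..T}" using elim B(1) by auto
    moreover have "ball 0 B \<subseteq> cbox (-T) T" using elim by (auto simp: ball_def dist_real_def)
    ultimately show ?case using B(2)[of "-T" T] integral_restrict_Int[of "{-T..T}" "{0..}" f]
      unfolding dist_norm cbox_interval by metis
  qed
qed

text \<open>
  The function \<open>h\<close> converges since \<open>h T = h 0 + \<integral>\<^sub>0\<^sup>T h'\<close>. Its mean over \<open>[T, T + 1]\<close> has the same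
  limit, but it is also a difference of two values of the convergent primitive of \<open>h\<close> and therefore
  tends to \<open>0\<close>.
\<close>

lemma integral_derivative_halfline:
  fixes h h' :: "real \<Rightarrow> 'a :: banach"
  assumes deriv: "\<And>t. t \<ge> 0 \<Longrightarrow> (h has_vector_derivative h' t) (at t within {0..})"
    and h: "h integrable_on {0..}" and h': "h' integrable_on {0..}"
  shows "integral {0..} h' = - h 0"
proof -
  define l where "l = integral {0..} h' + h 0"
  have FTC: "integral {0..T} h' + h 0 = h T" if "T \<ge> 0" for T
  proof -
    have "(h' has_integral h T - h 0) {0..T}"
      using that by (intro fundamental_theorem_of_calculus)
        (auto intro: has_vector_derivative_within_subset[OF deriv])
    then show ?thesis by (simp add: integral_unique)
  qed
  have "((\<lambda>T. integral {0..T} h' + h 0) \<longlongrightarrow> l) at_top"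
    unfolding l_def by (intro tendsto_intros tendsto_integral_halfline h')
  then have lim: "(h \<longlongrightarrow> l) at_top"
    by (rule Lim_transform_eventually) (rule eventually_mono[OF eventually_ge_at_top[of 0] FTC])
  have ivl: "h integrable_on {a..b}" if "0 \<le> a" for a b
    using integrable_on_subinterval[OF h, of a b] that by auto
  let ?F = "\<lambda>T. integral {0..T} h"
  have shift: "filterlim (\<lambda>T. T + 1) at_top (at_top :: real filter)"
    unfolding filterlim_at_top
  proof (intro allI)
    fix Z :: real
    show "\<forall>\<^sub>F T in at_top. Z \<le> T + 1"
      by (rule eventually_mono[OF eventually_ge_at_top[of Z]]) auto
  qed
  have "((\<lambda>T. ?F (T + 1) - ?F T) \<longlongrightarrow> integral {0..} h - integral {0..} h) at_top"
    by (intro tendsto_diff tendsto_integral_halfline[OF h]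
        filterlim_compose[OF tendsto_integral_halfline[OF h] shift])
  moreover have "((\<lambda>T. ?F (T + 1) - ?F T) \<longlongrightarrow> l) at_top"
  proof (rule tendstoI)
    fix e :: real assume e: "e > 0"
    obtain S where S: "\<And>t. t \<ge> S \<Longrightarrow> dist (h t) l < e / 2"
      using tendstoD[OF lim, of "e / 2"] e by (auto simp: eventually_at_top_linorder)
    show "\<forall>\<^sub>F T in at_top. dist (?F (T + 1) - ?F T) l < e"
      using eventually_ge_at_top[of "max 0 S"]
    proof eventually_elim
      case (elim T)
      have F: "?F (T + 1) - ?F T = integral {T..T+1} h"
        using Henstock_Kurzweil_Integration.integral_combine[of 0 T "T + 1" h] ivl elim by (simp add: algebra_simps)
      have integ: "((\<lambda>t. h t - l) has_integral integral {T..T+1} h - (T + 1 - T) *\<^sub>R l) (cbox T (T + 1))"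
        using elim has_integral_const_real[of l T "T + 1"]
        by (intro has_integral_diff) (auto intro!: integrable_integral ivl)
      have bound: "norm (h t - l) \<le> e / 2" if "t \<in> cbox T (T + 1)" for t
        using S[of t] that elim by (simp add: dist_norm less_imp_le)
      have "norm (integral {T..T+1} h - (T + 1 - T) *\<^sub>R l) \<le> e / 2"
        using has_integral_bound[OF _ integ bound] e by simp
      then show ?case using F e by (simp add: dist_norm)
    qed
  qed
  ultimately have "l = 0" using tendsto_unique[OF trivial_limit_at_top_linorder] by fastforce
  then show ?thesis unfolding l_def by (simp add: eq_neg_iff_add_eq_0)
qed

lemma pow_mat_smult:
  assumes "X \<in> carrier_mat n n"
  shows "(z \<cdot>\<^sub>m X) ^\<^sub>m k = z ^ k \<cdot>\<^sub>m (X ^\<^sub>m k :: 'a :: comm_ring_1 mat)"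
proof (induction k)
  case (Suc k)
  have "z ^ k \<cdot>\<^sub>m X ^\<^sub>m k * (z \<cdot>\<^sub>m X) = z ^ k \<cdot>\<^sub>m (z \<cdot>\<^sub>m (X ^\<^sub>m k * X))"
    using assms mult_smult_distrib[of "X ^\<^sub>m k" n n X n z]
      mult_smult_assoc_mat[of "X ^\<^sub>m k" n n "z \<cdot>\<^sub>m X" n "z ^ k"] by auto
  then show ?case using Suc by (intro eq_matI) (auto simp: mult.assoc mult.commute)
qed (use assms in \<open>auto intro!: eq_matI\<close>)

text \<open>
  The bound is crude, but geometric in \<open>k\<close> and uniform in the entry, which is what the
  exponential series needs.
\<close>

lemma norm_pow_mat_le:
  fixes X :: "'a :: real_normed_field mat"
  assumes X: "X \<in> carrier_mat n n" and i: "i < n" and j: "j < n"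
  shows "norm ((X ^\<^sub>m k) $$ (i, j)) \<le> (\<Sum>m<n. \<Sum>l<n. norm (X $$ (l, m))) ^ k"
  using j
proof (induction k arbitrary: j)
  case 0
  then show ?case using X i by auto
next
  case (Suc k)
  let ?c = "\<Sum>m<n. \<Sum>l<n. norm (X $$ (l, m))"
  have Xk: "X ^\<^sub>m k \<in> carrier_mat n n" using X by auto
  have "(X ^\<^sub>m Suc k) $$ (i, j) = (\<Sum>l<n. (X ^\<^sub>m k) $$ (i, l) * X $$ (l, j))"
    using X Xk i Suc.prems by (simp add: scalar_prod_def atLeast0LessThan)
  then have "norm ((X ^\<^sub>m Suc k) $$ (i, j)) \<le> (\<Sum>l<n. norm ((X ^\<^sub>m k) $$ (i, l)) * norm (X $$ (l, j)))"
    by (metis (no_types, lifting) norm_mult norm_sum sum.cong)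
  also have "\<dots> \<le> (\<Sum>l<n. ?c ^ k * norm (X $$ (l, j)))"
    by (intro sum_mono mult_right_mono Suc.IH) auto
  also have "\<dots> = ?c ^ k * (\<Sum>l<n. norm (X $$ (l, j)))" by (simp add: sum_distrib_left)
  also have "\<dots> \<le> ?c ^ k * ?c"
  proof (rule mult_left_mono)
    show "(\<Sum>l<n. norm (X $$ (l, j))) \<le> ?c"
      using Suc.prems by (intro member_le_sum) (auto intro: sum_nonneg)
    show "0 \<le> ?c ^ k" by (intro zero_le_power sum_nonneg norm_ge_zero)
  qed
  finally show ?case by (simp add: mult.commute)
qed

lemma mat_exp_summable:
  assumes X: "X \<in> carrier_mat n n" and i: "i < n" and j: "j < n"
  shows "summable (\<lambda>k. (X ^\<^sub>m k) $$ (i, j) / fact k * (z :: complex) ^ k)"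
proof (rule summable_comparison_test')
  let ?c = "\<Sum>m<n. \<Sum>l<n. norm (X $$ (l, m))"
  show "summable (\<lambda>k. inverse (fact k) * (?c * norm z) ^ k)" by (rule summable_exp)
  show "norm ((X ^\<^sub>m k) $$ (i, j) / fact k * z ^ k) \<le> inverse (fact k) * (?c * norm z) ^ k"
    if "k \<ge> 0" for k
    using mult_left_mono[OF norm_pow_mat_le[OF assms, of k], of "norm z ^ k"]
    by (simp add: norm_mult norm_divide norm_power power_mult_distrib field_simps)
qed

lemma mat_exp_smult_index:
  assumes X: "X \<in> carrier_mat n n" and i: "i < n" and j: "j < n"
  shows "mat_exp (z \<cdot>\<^sub>m X) $$ (i, j) = (\<Sum>k. (X ^\<^sub>m k) $$ (i, j) / fact k * z ^ k)"
  using assms unfolding mat_exp_def by (simp add: pow_mat_smult mult.commute)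

lemma mat_exp_carrier: "X \<in> carrier_mat n n \<Longrightarrow> mat_exp X \<in> carrier_mat n n"
  unfolding mat_exp_def by auto

text \<open>
  Each entry of \<open>exp (z X)\<close> is an everywhere convergent power series in \<open>z\<close>. Differentiating it
  termwise shifts the powers of \<open>X\<close> by one, which is multiplication by \<open>X\<close> from the right.
\<close>

lemma mat_exp_has_field_derivative:
  assumes X: "X \<in> carrier_mat n n" and i: "i < n" and j: "j < n"
  shows "((\<lambda>z. mat_exp (z \<cdot>\<^sub>m X) $$ (i, j)) has_field_derivative
    (mat_exp (z \<cdot>\<^sub>m X) * X) $$ (i, j)) (at z)"
proof -
  let ?c = "\<lambda>j k. (X ^\<^sub>m k) $$ (i, j) / fact k"
  have "((\<lambda>z. \<Sum>k. ?c j k * z ^ k) has_field_derivative (\<Sum>k. diffs (?c j) k * z ^ k)) (at z)"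
    by (intro termdiffs_strong_converges_everywhere mat_exp_summable[OF X i j])
  also have "(\<lambda>z. \<Sum>k. ?c j k * z ^ k) = (\<lambda>z. mat_exp (z \<cdot>\<^sub>m X) $$ (i, j))"
    by (simp add: mat_exp_smult_index[OF X i j])
  also have "(\<Sum>k. diffs (?c j) k * z ^ k) = (\<Sum>k. \<Sum>l<n. ?c l k * z ^ k * X $$ (l, j))"
  proof (rule arg_cong[where f = suminf], rule ext)
    fix k
    have Xk: "X ^\<^sub>m k \<in> carrier_mat n n" using X by auto
    have "diffs (?c j) k = (X ^\<^sub>m Suc k) $$ (i, j) / fact k"
      unfolding diffs_def by (simp add: field_simps del: pow_mat.simps of_nat_Suc)
    also have "(X ^\<^sub>m Suc k) $$ (i, j) = (\<Sum>l<n. (X ^\<^sub>m k) $$ (i, l) * X $$ (l, j))"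
      using X Xk i j by (simp add: scalar_prod_def atLeast0LessThan)
    finally show "diffs (?c j) k * z ^ k = (\<Sum>l<n. ?c l k * z ^ k * X $$ (l, j))"
      by (simp add: sum_divide_distrib sum_distrib_left mult_ac)
  qed
  also have "\<dots> = (\<Sum>l<n. \<Sum>k. ?c l k * z ^ k * X $$ (l, j))"
    by (intro suminf_sum summable_mult2 mat_exp_summable[OF X i]) auto
  also have "\<dots> = (\<Sum>l<n. mat_exp (z \<cdot>\<^sub>m X) $$ (i, l) * X $$ (l, j))"
    by (intro sum.cong refl)
      (simp only: mat_exp_smult_index[OF X i] lessThan_iff suminf_mult2[OF mat_exp_summable[OF X i]])
  also have "\<dots> = (mat_exp (z \<cdot>\<^sub>m X) * X) $$ (i, j)"
    using X i j mat_exp_carrier[of "z \<cdot>\<^sub>m X" n] by (simp add: scalar_prod_def atLeast0LessThan)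
  finally show ?thesis .
qed

lemma mult_mat_exp_has_vector_derivative:
  assumes M: "M \<in> carrier_mat p n" and X: "X \<in> carrier_mat n n" and i: "i < p" and j: "j < n"
  shows "((\<lambda>t. (M * mat_exp (complex_of_real t \<cdot>\<^sub>m X)) $$ (i, j)) has_vector_derivative
    (M * mat_exp (complex_of_real t \<cdot>\<^sub>m X) * X) $$ (i, j)) (at t within S)"
proof -
  have E: "mat_exp (z \<cdot>\<^sub>m X) \<in> carrier_mat n n" for z using X mat_exp_carrier by auto
  have EX: "mat_exp (z \<cdot>\<^sub>m X) * X \<in> carrier_mat n n" for z by (rule mult_carrier_mat[OF E X])
  have "((\<lambda>t. \<Sum>l<n. M $$ (i, l) * mat_exp (complex_of_real t \<cdot>\<^sub>m X) $$ (l, j)) has_vector_derivative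
      (\<Sum>l<n. M $$ (i, l) * (mat_exp (complex_of_real t \<cdot>\<^sub>m X) * X) $$ (l, j))) (at t within S)"
    by (intro has_vector_derivative_sum has_vector_derivative_mult_right
        has_vector_derivative_real_field mat_exp_has_field_derivative[OF X _ j]) auto
  moreover have "(M * Y) $$ (i, j) = (\<Sum>l<n. M $$ (i, l) * Y $$ (l, j))" if "Y \<in> carrier_mat n n" for Y
    using that M i j by (simp add: scalar_prod_def atLeast0LessThan)
  ultimately show ?thesis
    using E EX by (simp add: assoc_mult_mat[OF M E X])
qed

lemma mat_integrable_on_iff:
  assumes "\<And>t. f t \<in> carrier_mat p n"
  shows "mat_integrable_on f S \<longleftrightarrow> (\<forall>i<p. \<forall>j<n. (\<lambda>t. f t $$ (i, j)) integrable_on S)"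
  using assms[of 0] unfolding mat_integrable_on_def by auto

lemma mat_integral_mult_right:
  assumes f: "\<And>t. f t \<in> carrier_mat p n" and P: "P \<in> carrier_mat n m" and int: "mat_integrable_on f S"
  shows "mat_integrable_on (\<lambda>t. f t * P) S" "mat_integral S (\<lambda>t. f t * P) = mat_integral S f * P"
proof -
  have entry: "(f t * P) $$ (i, j) = (\<Sum>l<n. f t $$ (i, l) * P $$ (l, j))" if "i < p" "j < m" for t i j
    using f[of t] P that by (simp add: scalar_prod_def atLeast0LessThan)
  have int': "(\<lambda>t. f t $$ (i, l)) integrable_on S" if "i < p" "l < n" for i l
    using int that f[of 0] unfolding mat_integrable_on_def by auto
  have *: "((\<lambda>t. (f t * P) $$ (i, j)) has_integral
      (\<Sum>l<n. integral S (\<lambda>t. f t $$ (i, l)) * P $$ (l, j))) S" if "i < p" "j < m" for i j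
    unfolding entry[OF that]
    by (intro has_integral_sum has_integral_mult_left integrable_integral int' that) auto
  have dims: "dim_row (f 0) = p" "dim_col (f 0) = n" using f[of 0] by auto
  show "mat_integrable_on (\<lambda>t. f t * P) S"
    unfolding mat_integrable_on_def using * P dims by (auto simp: integrable_on_def)
  show "mat_integral S (\<lambda>t. f t * P) = mat_integral S f * P"
    unfolding mat_integral_def using P dims integral_unique[OF *]
    by (intro eq_matI) (auto simp: scalar_prod_def atLeast0LessThan)
qed

text \<open>
  The integral \<open>I\<close> satisfies \<open>I X = - M\<close>, because \<open>M exp (t X) X\<close> is the derivative of \<open>M exp (t X)\<close>.
  If \<open>M\<close> annihilates the directions in which \<open>exp (t X)\<close> grows, the integral can converge although
  the exponential itself is unbounded.
\<close>

lemma mat_integral_exp_mult_generator: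
  assumes M: "M \<in> carrier_mat p n" and X: "X \<in> carrier_mat n n"
    and int: "mat_integrable_on (\<lambda>t. M * mat_exp (complex_of_real t \<cdot>\<^sub>m X)) {0..}"
  shows "mat_integral {0..} (\<lambda>t. M * mat_exp (complex_of_real t \<cdot>\<^sub>m X)) * X = - M"
proof -
  let ?h = "\<lambda>t. M * mat_exp (complex_of_real t \<cdot>\<^sub>m X)"
  have E: "mat_exp (z \<cdot>\<^sub>m X) \<in> carrier_mat n n" for z using X mat_exp_carrier by auto
  have h: "?h t \<in> carrier_mat p n" for t using M E by auto
  have hX: "?h t * X \<in> carrier_mat p n" for t by (rule mult_carrier_mat[OF h X])
  have "mat_exp (0 \<cdot>\<^sub>m X) = 1\<^sub>m n"
  proof (rule eq_matI)
    fix i j assume "i < dim_row (1\<^sub>m n :: complex mat)" "j < dim_col (1\<^sub>m n :: complex mat)"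
    then have ij: "i < n" "j < n" by auto
    have "mat_exp (0 \<cdot>\<^sub>m X) $$ (i, j) = (X ^\<^sub>m 0) $$ (i, j) / fact 0"
      unfolding mat_exp_smult_index[OF X ij] by (rule powser_zero)
    then show "mat_exp (0 \<cdot>\<^sub>m X) $$ (i, j) = 1\<^sub>m n $$ (i, j)" using X by simp
  qed (use E[of 0] in auto)
  then have h0: "?h 0 = M" using M by simp
  note intX = mat_integral_mult_right[OF h X int]
  have "mat_integral {0..} (\<lambda>t. ?h t * X) = - M"
  proof (rule eq_matI)
    fix i j assume "i < dim_row (- M)" "j < dim_col (- M)"
    then have ij: "i < p" "j < n" using M by auto
    have "integral {0..} (\<lambda>t. (?h t * X) $$ (i, j)) = - (?h 0) $$ (i, j)"
    proof (rule integral_derivative_halfline)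
      show "((\<lambda>t. ?h t $$ (i, j)) has_vector_derivative (?h t * X) $$ (i, j)) (at t within {0..})" for t
        by (rule mult_mat_exp_has_vector_derivative[OF M X ij])
      show "(\<lambda>t. ?h t $$ (i, j)) integrable_on {0..}"
        using int ij unfolding mat_integrable_on_iff[OF h] by auto
      show "(\<lambda>t. (?h t * X) $$ (i, j)) integrable_on {0..}"
        using intX(1) ij unfolding mat_integrable_on_iff[OF hX] by blast
    qed
    then show "mat_integral {0..} (\<lambda>t. ?h t * X) $$ (i, j) = (- M) $$ (i, j)"
      unfolding mat_integral_def using hX[of 0] ij M h0 by auto
  qed (use M hX[of 0] X in \<open>auto simp: mat_integral_def\<close>)
  with intX(2) show ?thesis by simp
qed

section \<open>The integral representation\<close>

theorem theorem4p5:
  fixes A M :: "complex mat" and B C :: "nat \<Rightarrow> complex mat" and n k :: nat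
  assumes "A \<in> carrier_mat n n"
    and "mat_index A = k" and "k \<ge> 1"
    and "mat_rank (minkowski_adjoint A * A * minkowski_adjoint A) = mat_rank A"
    and "mat_rank A > 0"
    and "A ^\<^sub>m k \<noteq> 0\<^sub>m n n"
    and "full_rank_factorization A (B 1) (C 1)"
    and "\<And>i. 1 \<le> i \<Longrightarrow> i \<le> k - 1 \<Longrightarrow>
           full_rank_factorization (C i * B i) (B (i + 1)) (C (i + 1))"
    and "M = mat_prod_up B k * (the (mat_inverse (C k * B k)) ^\<^sub>m k) * mat_prod_down C k"
    and integral_converges:
      "mat_integrable_on
         (\<lambda>t. M * mat_exp (complex_of_real t \<cdot>\<^sub>m (- (minkowski_adjoint (B 1) * B 1)))
              * minkowski_adjoint (B 1)) {0..}"
  shows "m_DMP_inverse A =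
    mat_integral {0..}
      (\<lambda>t. M * mat_exp (complex_of_real t \<cdot>\<^sub>m (- (minkowski_adjoint (B 1) * B 1)))
           * minkowski_adjoint (B 1))"
proof -
  define r where "r = dim_col (B k)"
  define s where "s = dim_col (B 1)"
  define U where "U = mat_prod_up B k"
  define V where "V = mat_prod_down C k"
  define K where "K = C k * B k"
  define B\<^sub>1 where "B\<^sub>1 = B 1"
  define C\<^sub>1 where "C\<^sub>1 = C 1"
  let ?B' = "minkowski_adjoint B\<^sub>1" and ?C' = "minkowski_adjoint C\<^sub>1"
  note A = assms(1) and k = assms(2)[symmetric]
  note D = full_rank_factorizationD[OF assms(7)]
  have B1: "B\<^sub>1 \<in> carrier_mat n s" and C1: "C\<^sub>1 \<in> carrier_mat s n" and A_eq: "A = B\<^sub>1 * C\<^sub>1"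
    using D(1-3) unfolding s_def B\<^sub>1_def C\<^sub>1_def carrier_matD[OF A] .
  have "B 1 \<in> carrier_mat (dim_row A) (mat_rank A)"
    using assms(7) unfolding full_rank_factorization_def Let_def by blast
  then have rankA: "mat_rank A = s" unfolding s_def by (rule carrier_matD(2)[symmetric])
  have factor: "full_rank_factorization (C i * B i) (B (Suc i)) (C (Suc i))" if "1 \<le> i" "i < k" for i
    using assms(8)[of i] that by simp
  note chain = iterated_full_rank_factorization[OF assms(3) assms(7) A factor,
      folded U_def V_def r_def s_def K_def B\<^sub>1_def C\<^sub>1_def]
  have U: "U \<in> carrier_mat n r" and V: "V \<in> carrier_mat r s"
    and AU: "A * U = U * K" and VK: "V * (C\<^sub>1 * B\<^sub>1) = K * V" and Ak: "A ^\<^sub>m k = U * (V * C\<^sub>1)"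
    using chain by blast+
  have K: "K \<in> carrier_mat r r"
    using chain(3) unfolding K_def r_def by (auto intro!: carrier_matI)
  obtain L where L: "L \<in> carrier_mat r n" "L * U = 1\<^sub>m r" using chain by blast
  obtain R where R: "R \<in> carrier_mat n r" "(V * C\<^sub>1) * R = 1\<^sub>m r" using chain by blast
  have VC: "V * C\<^sub>1 \<in> carrier_mat r n" by (rule mult_carrier_mat[OF V C1])
  obtain J where J: "J \<in> carrier_mat r r" "K * J = 1\<^sub>m r" "J * K = 1\<^sub>m r"
    using core_part_invertible[OF A k U VC K L R AU Ak] .
  have M_eq: "M = U * J ^\<^sub>m k * V"
    unfolding assms(9) U_def V_def K_def[symmetric] mat_inverse_eqI[OF K J] by simp
  have [simp]: "dim_row A = n" "dim_col A = n" "dim_row U = n" "dim_col U = r"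
    "dim_row V = r" "dim_col V = s" "dim_row K = r" "dim_col K = r"
    "dim_row J = r" "dim_col J = r" "dim_row B\<^sub>1 = n" "dim_col B\<^sub>1 = s"
    "dim_row C\<^sub>1 = s" "dim_col C\<^sub>1 = n"
    using A U V K J(1) B1 C1 by auto
  have "(V * C\<^sub>1) * A = (V * (C\<^sub>1 * B\<^sub>1)) * C\<^sub>1" unfolding A_eq by (simp add: mult_assoc_dim)
  then have WA: "(V * C\<^sub>1) * A = K * (V * C\<^sub>1)" unfolding VK by (simp add: mult_assoc_dim)
  define P where "P = J ^\<^sub>m k"
  have P: "P \<in> carrier_mat r r" unfolding P_def by (rule pow_carrier_mat[OF J(1)])
  then have [simp]: "dim_row P = r" "dim_col P = r" by auto
  \<comment> \<open>One factor \<open>J\<close> is split off, to be cancelled later by the \<open>K\<close> that \<open>V (C\<^sub>1 B\<^sub>1) = K V\<close> produces.\<close>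
  have drazin: "drazin_inverse A = U * (P * J) * (V * C\<^sub>1)"
    using drazin_inverse_eqI[OF A is_drazin_inverse_compression[OF k A U VC K L AU WA Ak J]]
    by (simp add: P_def)
  obtain N H where N: "N \<in> carrier_mat s s" "(?B' * B\<^sub>1) * N = 1\<^sub>m s" "N * (?B' * B\<^sub>1) = 1\<^sub>m s"
    and H: "H \<in> carrier_mat s s" "(C\<^sub>1 * ?C') * H = 1\<^sub>m s" "H * (C\<^sub>1 * ?C') = 1\<^sub>m s"
    using minkowski_gram_inverses[OF B1 C1] assms(4) rankA unfolding A_eq by auto
  have [simp]: "dim_row N = s" "dim_col N = s" "dim_row H = s" "dim_col H = s"
    using N(1) H(1) by auto
  have minv: "minkowski_inverse A = ?C' * H * N * ?B'"
    unfolding A_eq by (rule minkowski_inverse_eqI[OF is_minkowski_inverse_full_rank_form[OF B1 C1 N H]])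
  have "A * minkowski_inverse A = B\<^sub>1 * (((C\<^sub>1 * ?C') * H) * (N * ?B'))"
    unfolding minv unfolding A_eq by (simp add: mult_assoc_dim)
  also have "\<dots> = B\<^sub>1 * (N * ?B')"
    unfolding H(2) by (subst left_mult_one_mat) auto
  finally have AX: "A * minkowski_inverse A = B\<^sub>1 * (N * ?B')" .
  have "m_DMP_inverse A = U * (P * J) * (V * C\<^sub>1) * (A * minkowski_inverse A)"
    unfolding m_DMP_inverse_def drazin by (rule mult_assoc_dim) (simp_all add: minv)
  also have "\<dots> = U * (P * J) * (V * (C\<^sub>1 * B\<^sub>1)) * (N * ?B')"
    unfolding AX by (simp add: mult_assoc_dim)
  also have "\<dots> = U * (P * (J * K)) * V * (N * ?B')"
    unfolding VK by (simp add: mult_assoc_dim)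
  also have "\<dots> = M * N * ?B'"
    unfolding J(3) M_eq P_def[symmetric] by (simp add: mult_assoc_dim right_mult_one_mat[OF P])
  finally have dmp: "m_DMP_inverse A = M * N * ?B'" .

  define G where "G = ?B' * B\<^sub>1"
  have B': "?B' \<in> carrier_mat s n" using B1 by auto
  have G: "G \<in> carrier_mat s s" unfolding G_def by (rule mult_carrier_mat[OF B' B1])
  have M: "M \<in> carrier_mat n s" unfolding M_eq P_def[symmetric] by (auto intro!: carrier_matI)
  let ?h = "\<lambda>t. M * mat_exp (complex_of_real t \<cdot>\<^sub>m (- G))"
  have h: "?h t \<in> carrier_mat n s" for t
    using mult_carrier_mat[OF M mat_exp_carrier[of "complex_of_real t \<cdot>\<^sub>m (- G)" s]] G by auto
  note conv = integral_converges[folded B\<^sub>1_def, folded G_def]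
  \<comment> \<open>A right inverse of \<open>B\<^sub>1\<^sup>\<sim>\<close> strips that factor from the integrand and keeps integrability.\<close>
  obtain Q where Q: "Q \<in> carrier_mat n s" "?B' * Q = 1\<^sub>m s"
  proof
    show "B\<^sub>1 * N \<in> carrier_mat n s" by (rule mult_carrier_mat[OF B1 N(1)])
    show "?B' * (B\<^sub>1 * N) = 1\<^sub>m s"
      using N(2) by (simp add: mult_assoc_dim)
  qed
  have "mat_integrable_on (\<lambda>t. ?h t * ?B' * Q) {0..}"
    by (rule mat_integral_mult_right(1)[OF mult_carrier_mat[OF h B'] Q(1) conv])
  then have int_h: "mat_integrable_on ?h {0..}"
    by (simp only: assoc_mult_mat[OF h B' Q(1)] Q(2) right_mult_one_mat[OF h])
  define I where "I = mat_integral {0..} ?h"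
  have I: "I \<in> carrier_mat n s"
    unfolding I_def mat_integral_def using h[of 0] by (auto intro!: carrier_matI)
  have "I * (- G) = - M"
    unfolding I_def by (rule mat_integral_exp_mult_generator[OF M _ int_h]) (use G in auto)
  then have "I * G = M"
    using I G M by (metis uminus_mult_right_mat uminus_uminus_mat carrier_matD)
  then have "M * N = I * (G * N)" using I G N(1) by (auto simp: mult_assoc_dim)
  then have MN: "M * N = I" unfolding G_def N(2) using I by simp
  have "mat_integral {0..} (\<lambda>t. ?h t * ?B') = M * N * ?B'"
    unfolding MN I_def by (rule mat_integral_mult_right(2)[OF h B' int_h])
  then show ?thesis unfolding dmp G_def B\<^sub>1_def by simp
qed

end
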